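(* $|\mathcal{L}_f|=|\mathcal{L}_\omega|=\beth_2=2^{2^{\aleph_0}}$, where $\mathcal{L}_f$ is the set of all functional clones and $\mathcal{L}_\omega$ is the set of all $\omega$-clones.
   Context: $\mathcal{B}_k$ is the set of functions $\{0,1\}^k\to\mathbb{R}_{\ge0}$, $\mathcal{B}=\bigcup_{k\ge0}\mathcal{B}_k$. $\mathrm{EQ}\in\mathcal{B}_2$ is the binary equality indicator. For $\mathcal{F}\subseteq\mathcal{B}$, $\langle\mathcal{F}\rangle$ is the closure of $\mathcal{F}\cup\{\mathrm{EQ}\}$ under introducing fictitious arguments, permuting arguments, pointwise product of equal-arity functions, and summing out an argument over $\{0,1\}$. A $k$-ary $f$ is a limit of $\mathcal{F}$ if there is a finite $S\subseteq\mathcal{F}$ such that for all $\epsilon>0$ some $k$-ary $f_\epsilon\in\langle S\rangle$ has $\max_\mathbf{x}|f(\mathbf{x})-f_\epsilon(\mathbf{x})|<\epsilon$; $\langle\mathcal{F}\rangle_\omega$ is the closure of $\mathcal{F}\cup\{\mathrm{EQ}\}$ under the four operations and limits. A functional clone is a set $\mathcal{F}\subseteq\mathcal{B}$ with $\langle\mathcal{F}\rangle=\mathcal{F}$; an $\omega$-clone is a set with $\langle\mathcal{F}\rangle_\omega=\mathcal{F}$. *)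

theory Defs
  imports Complex_Main "HOL-Library.FuncSet" "HOL-Combinatorics.Permutations"
begin

unbundle cardinal_syntax

definition cube :: "nat \<Rightarrow> bool list set" where
  "cube k = {xs. length xs = k}"

text \<open>A function carries its arity as first component, so that the sets \<^term>\<open>Bk k\<close> below are
  pairwise disjoint; the second component is \<^term>\<open>undefined\<close> outside \<^term>\<open>cube k\<close>, so that
  equality of pairs is equality of functions.\<close>

type_synonym bfun = "nat \<times> (bool list \<Rightarrow> real)"

definition Bk :: "nat \<Rightarrow> bfun set" where
  "Bk k = {k} \<times> (cube k \<rightarrow>\<^sub>E {0..})"

definition B :: "bfun set" where
  "B = (\<Union>k. Bk k)"

definition EQ :: bfun where
  "EQ = (2, \<lambda>xs\<in>cube 2. if xs ! 0 = xs ! 1 then 1 else 0)"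

text \<open>Arguments are numbered from \<open>0\<close>. The new fictitious argument is the one with index \<open>i\<close>
  (used for \<open>i \<le> k\<close>).\<close>

definition fictitious :: "nat \<Rightarrow> bfun \<Rightarrow> bfun" where
  "fictitious i = (\<lambda>(k, f). (Suc k, \<lambda>xs\<in>cube (Suc k). f (take i xs @ drop (Suc i) xs)))"

definition permute_args :: "(nat \<Rightarrow> nat) \<Rightarrow> bfun \<Rightarrow> bfun" where
  "permute_args \<pi> = (\<lambda>(k, f). (k, \<lambda>xs\<in>cube k. f (permute_list \<pi> xs)))"

text \<open>Used only when both arities agree.\<close>

definition pointwise_product :: "bfun \<Rightarrow> bfun \<Rightarrow> bfun" where
  "pointwise_product = (\<lambda>(k, f) (_, g). (k, \<lambda>xs\<in>cube k. f xs * g xs))"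

text \<open>Sums over the argument with index \<open>i\<close> (used for \<open>i < k\<close>, so that \<open>k\<close> is positive).\<close>

definition sum_out :: "nat \<Rightarrow> bfun \<Rightarrow> bfun" where
  "sum_out i = (\<lambda>(k, f). (k - 1, \<lambda>xs\<in>cube (k - 1). \<Sum>b\<in>UNIV. f (take i xs @ b # drop i xs)))"

definition closed_ops :: "bfun set \<Rightarrow> bool" where
  "closed_ops G \<longleftrightarrow>
    (\<forall>k f i. (k, f) \<in> G \<and> i \<le> k \<longrightarrow> fictitious i (k, f) \<in> G) \<and>
    (\<forall>k f \<pi>. (k, f) \<in> G \<and> \<pi> permutes {..<k} \<longrightarrow> permute_args \<pi> (k, f) \<in> G) \<and>
    (\<forall>k f g. (k, f) \<in> G \<and> (k, g) \<in> G \<longrightarrow> pointwise_product (k, f) (k, g) \<in> G) \<and>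
    (\<forall>k f i. (k, f) \<in> G \<and> i < k \<longrightarrow> sum_out i (k, f) \<in> G)"

definition clone_closure :: "bfun set \<Rightarrow> bfun set" where
  "clone_closure F = closed_ops hull (F \<union> {EQ})"

definition is_limit :: "bfun set \<Rightarrow> nat \<Rightarrow> (bool list \<Rightarrow> real) \<Rightarrow> bool" where
  "is_limit F k f \<longleftrightarrow> (k, f) \<in> Bk k \<and>
    (\<exists>S. finite S \<and> S \<subseteq> F \<and>
      (\<forall>\<epsilon>>0. \<exists>g. (k, g) \<in> clone_closure S \<and> (MAX xs\<in>cube k. \<bar>f xs - g xs\<bar>) < \<epsilon>))"

definition closed_limits :: "bfun set \<Rightarrow> bool" where
  "closed_limits G \<longleftrightarrow> (\<forall>k f. is_limit G k f \<longrightarrow> (k, f) \<in> G)"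

definition omega_closure :: "bfun set \<Rightarrow> bfun set" where
  "omega_closure F = (\<lambda>G. closed_ops G \<and> closed_limits G) hull (F \<union> {EQ})"

definition functional_clone :: "bfun set \<Rightarrow> bool" where
  "functional_clone F \<longleftrightarrow> F \<subseteq> B \<and> clone_closure F = F"

definition omega_clone :: "bfun set \<Rightarrow> bool" where
  "omega_clone F \<longleftrightarrow> F \<subseteq> B \<and> omega_closure F = F"

definition L_f :: "bfun set set" where
  "L_f = {F. functional_clone F}"

definition L_omega :: "bfun set set" where
  "L_omega = {F. omega_clone F}"

end

theory Submission
  imports Defs "HOL-Analysis.Abstract_Topology_2" "HOL-Analysis.Elementary_Metric_Spaces"
begin

text \<open>Upper bound: a function is determined by its arity and countably many Dedekind cuts, so there
  are at most \<open>2\<close> to the continuum many sets of functions.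

  Lower bound: for a multiplicative monoid \<open>T\<close> of nonnegative reals, the functions
  \<open>c * (\<Prod>i. w i (x i)) * [some equalities between arguments]\<close> with \<open>w i 1 = 1\<close> and \<open>w i 0 \<in> T\<close> are
  closed under the four operations: a summed argument either is tied to another one, which is a
  substitution, or contributes a constant factor. Every \<open>A\<close> contained in the interval from \<open>1/4\<close> to
  \<open>1/2\<close> gives such a monoid \<open>{0..1/4} \<union> A \<union> {1}\<close>, because all products of its elements other than
  \<open>1\<close> fall below \<open>1/4\<close>; and \<open>A\<close> can be read off the unary functions. A finite set of functions only
  uses a finite part of \<open>A\<close>, for which the monoid is compact, so limits do not leave the class.\<close>

section \<open>Weighted equality constraints\<close>

text \<open>The value at \<open>True\<close> is normalised to 1, so a weight is a single real and
  pointwise products of weights are products of reals. Scaling is left to the constant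
  \<open>c\<close> of \<open>wprod\<close>.\<close>

definition weight :: "real \<Rightarrow> bool \<Rightarrow> real" where
  "weight t b = (if b then 1 else t)"

text \<open>\<open>E\<close> is an arbitrary relation rather than an equivalence: products of
  functions then take unions of constraint sets, and substitutions take images, with no closure
  step.\<close>

definition wprod :: "nat \<Rightarrow> real \<Rightarrow> (nat \<Rightarrow> real) \<Rightarrow> (nat \<times> nat) set \<Rightarrow> bool list \<Rightarrow> real" where
  "wprod k c t E xs =
    c * (\<Prod>i<k. weight (t i) (xs ! i)) * of_bool (\<forall>(i, j)\<in>E. xs ! i = xs ! j)"

text \<open>Only the weights are restricted to \<open>T\<close>. The constant may be any nonnegative
  real, since summing out an argument multiplies it by factors \<open>1 + t i\<close> that can leave
  \<open>T\<close>.\<close>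

definition weighted :: "real set \<Rightarrow> bfun set" where
  "weighted T = {(k, \<lambda>xs\<in>cube k. wprod k c t E xs) | k c t E.
    0 \<le> c \<and> t ` {..<k} \<subseteq> T \<and> E \<subseteq> {..<k} \<times> {..<k}}"

text \<open>Substitution of variables: argument \<open>i\<close> of \<open>f\<close> reads
  coordinate \<open>\<phi> i\<close> of the new argument list. Fictitious arguments, permutations
  and identifications of arguments are all instances.\<close>

definition reindex :: "nat \<Rightarrow> (nat \<Rightarrow> nat) \<Rightarrow> bfun \<Rightarrow> bfun" where
  "reindex m \<phi> = (\<lambda>(k, f). (m, \<lambda>xs\<in>cube m. f (map (\<lambda>i. xs ! \<phi> i) [0..<k])))"

lemma weight_mult: "weight s b * weight t b = weight (s * t) b"
  by (simp add: weight_def)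

lemma weight_prod: "(\<Prod>i\<in>I. weight (t i) b) = weight (\<Prod>i\<in>I. t i) b"
  by (simp add: weight_def)

lemma weight_one [simp]: "weight 1 b = 1"
  by (simp add: weight_def)

lemma weightedI:
  assumes "0 \<le> c" "\<And>i. i < k \<Longrightarrow> t i \<in> T" "E \<subseteq> {..<k} \<times> {..<k}"
    and "f \<in> extensional (cube k)" "\<And>xs. length xs = k \<Longrightarrow> f xs = wprod k c t E xs"
  shows "(k, f) \<in> weighted T"
proof -
  have "f = (\<lambda>xs\<in>cube k. wprod k c t E xs)"
    using assms(4,5) by (auto simp: fun_eq_iff extensional_def cube_def)
  with assms show ?thesis unfolding weighted_def by blast
qed

lemma weightedE:
  assumes "(k, f) \<in> weighted T"
  obtains c t E where "0 \<le> c" "\<And>i. i < k \<Longrightarrow> t i \<in> T" "E \<subseteq> {..<k} \<times> {..<k}"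
    "f \<in> extensional (cube k)" "\<And>xs. length xs = k \<Longrightarrow> f xs = wprod k c t E xs"
proof -
  from assms obtain c t E where "0 \<le> c" "t ` {..<k} \<subseteq> T" "E \<subseteq> {..<k} \<times> {..<k}"
    "f = (\<lambda>xs\<in>cube k. wprod k c t E xs)"
    unfolding weighted_def by auto
  then show thesis by (intro that[of c t E]) (auto simp: cube_def)
qed

lemma weighted_mono:
  assumes "T \<subseteq> U"
  shows "weighted T \<subseteq> weighted U"
proof (rule subrelI)
  fix k f assume "(k, f) \<in> weighted T"
  then obtain c t E where "0 \<le> c" "\<And>i. i < k \<Longrightarrow> t i \<in> T" "E \<subseteq> {..<k} \<times> {..<k}"
    "f \<in> extensional (cube k)" "\<And>xs. length xs = k \<Longrightarrow> f xs = wprod k c t E xs"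
    by (rule weightedE) blast
  then show "(k, f) \<in> weighted U"
    using assms by (intro weightedI[of c k t U E f]) auto
qed

lemma finite_cube [simp]: "finite (cube k)"
  unfolding cube_def using finite_lists_length_eq[of "UNIV :: bool set" k] by simp

lemma wprod_nonneg: "0 \<le> c \<Longrightarrow> (\<And>i. i < k \<Longrightarrow> 0 \<le> t i) \<Longrightarrow> 0 \<le> wprod k c t E xs"
  unfolding wprod_def by (intro mult_nonneg_nonneg prod_nonneg) (auto simp: weight_def)

lemma weighted_subset_B:
  assumes "T \<subseteq> {0..}"
  shows "weighted T \<subseteq> B"
proof
  fix p assume "p \<in> weighted T"
  then obtain k c t E where "p = (k, \<lambda>xs\<in>cube k. wprod k c t E xs)" "0 \<le> c" "t ` {..<k} \<subseteq> T"
    unfolding weighted_def by blast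
  with assms show "p \<in> B"
    unfolding B_def Bk_def by (force intro!: wprod_nonneg)
qed

text \<open>Serves the summation of a unary function, where no argument remains to
  substitute.\<close>

lemma weighted_nullary:
  assumes "f \<in> extensional (cube 0)" "0 \<le> f []"
  shows "(0, f) \<in> weighted T"
  by (rule weightedI[of "f []" _ _ _ "{}"]) (use assms in \<open>auto simp: wprod_def\<close>)

section \<open>Closure under the four operations\<close>

lemma prod_in:
  fixes T :: "real set"
  assumes "1 \<in> T" "\<And>x y. x \<in> T \<Longrightarrow> y \<in> T \<Longrightarrow> x * y \<in> T" "\<And>i. i \<in> I \<Longrightarrow> t i \<in> T"
  shows "prod t I \<in> T"
  using assms(3) by (induction I rule: infinite_finite_induct) (auto intro: assms(1,2))

text \<open>The new weight at \<open>l\<close> is the product of the old weights over the fibre of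
  \<open>\<phi>\<close> at \<open>l\<close>; an empty fibre gives 1. This is where \<open>T\<close>
  has to be a monoid. Constraints are carried along by their image.\<close>

lemma reindex_weighted:
  assumes T: "1 \<in> T" "\<And>x y. x \<in> T \<Longrightarrow> y \<in> T \<Longrightarrow> x * y \<in> T"
    and f: "(k, f) \<in> weighted T" and \<phi>: "\<And>i. i < k \<Longrightarrow> \<phi> i < m"
  shows "reindex m \<phi> (k, f) \<in> weighted T"
proof -
  obtain c t E where f: "0 \<le> c" "\<And>i. i < k \<Longrightarrow> t i \<in> T" "E \<subseteq> {..<k} \<times> {..<k}"
    "\<And>xs. length xs = k \<Longrightarrow> f xs = wprod k c t E xs"
    using weightedE[OF f] by metis
  define s where "s l = prod t {i\<in>{..<k}. \<phi> i = l}" for l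
  have "f (map (\<lambda>i. xs ! \<phi> i) [0..<k]) = wprod m c s (map_prod \<phi> \<phi> ` E) xs" for xs
  proof -
    have "(\<Prod>i<k. weight (t i) (xs ! \<phi> i)) =
      (\<Prod>l<m. \<Prod>i\<in>{i\<in>{..<k}. \<phi> i = l}. weight (t i) (xs ! \<phi> i))"
      by (rule prod.group[symmetric]) (use \<phi> in auto)
    also have "\<dots> = (\<Prod>l<m. weight (s l) (xs ! l))"
      unfolding s_def weight_prod[symmetric] by (intro prod.cong) auto
    finally have 1: "(\<Prod>i<k. weight (t i) (map (\<lambda>i. xs ! \<phi> i) [0..<k] ! i)) = \<dots>"
      by simp
    have "map (\<lambda>i. xs ! \<phi> i) [0..<k] ! i = xs ! \<phi> i \<and> map (\<lambda>i. xs ! \<phi> i) [0..<k] ! j = xs ! \<phi> j"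
      if "(i, j) \<in> E" for i j
      using f(3) that by auto
    then have 2: "(\<forall>(i, j)\<in>E. map (\<lambda>i. xs ! \<phi> i) [0..<k] ! i = map (\<lambda>i. xs ! \<phi> i) [0..<k] ! j)
      \<longleftrightarrow> (\<forall>(i, j)\<in>map_prod \<phi> \<phi> ` E. xs ! i = xs ! j)"
      by force
    show ?thesis
      by (subst f(4)) (simp_all only: wprod_def 1 2 length_map length_upt diff_zero)
  qed
  moreover have "s l \<in> T" for l
    unfolding s_def by (rule prod_in) (use T f(2) in auto)
  moreover have "map_prod \<phi> \<phi> ` E \<subseteq> {..<m} \<times> {..<m}"
    using f(3) \<phi> by fastforce
  ultimately show ?thesis
    unfolding reindex_def prod.case using f(1)
    by (intro weightedI[of c _ s _ "map_prod \<phi> \<phi> ` E"]) (auto simp: cube_def)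
qed

lemma fictitious_eq_reindex:
  assumes "i \<le> k"
  shows "fictitious i (k, f) = reindex (Suc k) (\<lambda>j. if j < i then j else Suc j) (k, f)"
proof -
  have "take i xs @ drop (Suc i) xs = map (\<lambda>j. xs ! (if j < i then j else Suc j)) [0..<k]"
    if "length xs = Suc k" for xs :: "bool list"
    using that assms by (intro nth_equalityI) (auto simp: nth_append)
  then show ?thesis
    by (auto simp: fictitious_def reindex_def cube_def fun_eq_iff)
qed

lemma permute_args_eq_reindex: "permute_args \<pi> (k, f) = reindex k \<pi> (k, f)"
  by (auto simp: permute_args_def reindex_def cube_def fun_eq_iff permute_list_def)

lemma nth_insert:
  assumes "i \<le> length xs"
  shows "(take i xs @ b # drop i xs) ! j =
    (if j < i then xs ! j else if j = i then b else xs ! (j - 1))"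
  using assms by (auto simp: nth_append nth_Cons' min_def)

text \<open>Inserting a copy of an existing entry is a substitution; this restores an argument whose
  value an equality constraint dictates.\<close>

lemma insert_eq_map:
  assumes "i \<le> length xs"
  shows "take i xs @ xs ! l # drop i xs =
    map (\<lambda>j. xs ! (if j < i then j else if j = i then l else j - 1)) [0..<Suc (length xs)]"
  using assms by (intro nth_equalityI) (auto simp: nth_insert simp del: upt_Suc)

lemma product_weighted:
  assumes T: "\<And>x y. x \<in> T \<Longrightarrow> y \<in> T \<Longrightarrow> x * y \<in> T"
    and "(k, f) \<in> weighted T" "(k, g) \<in> weighted T"
  shows "pointwise_product (k, f) (k, g) \<in> weighted T"
proof -
  obtain c t E where f: "0 \<le> c" "\<And>i. i < k \<Longrightarrow> t i \<in> T" "E \<subseteq> {..<k} \<times> {..<k}"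
    "\<And>xs. length xs = k \<Longrightarrow> f xs = wprod k c t E xs"
    using weightedE[OF assms(2)] by metis
  obtain d s F where g: "0 \<le> d" "\<And>i. i < k \<Longrightarrow> s i \<in> T" "F \<subseteq> {..<k} \<times> {..<k}"
    "\<And>xs. length xs = k \<Longrightarrow> g xs = wprod k d s F xs"
    using weightedE[OF assms(3)] by metis
  show ?thesis
    unfolding pointwise_product_def prod.case
  proof (rule weightedI[of "c * d" _ "\<lambda>i. t i * s i" _ "E \<union> F"])
    fix xs :: "bool list" assume "length xs = k"
    then show "(\<lambda>xs\<in>cube k. f xs * g xs) xs = wprod k (c * d) (\<lambda>i. t i * s i) (E \<union> F) xs"
      by (simp add: cube_def f g wprod_def weight_mult[symmetric] prod.distrib ball_Un)
  qed (use f g T in auto)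
qed

lemma sum_out_weighted:
  assumes T: "1 \<in> T" "\<And>x y. x \<in> T \<Longrightarrow> y \<in> T \<Longrightarrow> x * y \<in> T" "T \<subseteq> {0..}"
    and f0: "(k, f) \<in> weighted T" and i: "i < k"
  shows "sum_out i (k, f) \<in> weighted T"
proof -
  obtain m where k: "k = Suc m"
    using i by (cases k) auto
  obtain c t E where f: "0 \<le> c" "\<And>i. i < k \<Longrightarrow> t i \<in> T" "E \<subseteq> {..<k} \<times> {..<k}"
    "\<And>xs. length xs = k \<Longrightarrow> f xs = wprod k c t E xs"
    using weightedE[OF f0] by metis
  have fins: "f (take i xs @ b # drop i xs) = wprod k c t E (take i xs @ b # drop i xs)"
    if "length xs = m" for xs b
    using that i k by (intro f(4)) simp
  \<comment> \<open>\<open>\<phi> l\<close> fills position \<open>i\<close> of the longer list with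
    a copy of coordinate \<open>l\<close> and shifts the later positions back by one.\<close>
  define \<phi> where "\<phi> l j = (if j < i then j else if j = i then l else j - 1)" for l j
  have \<phi>: "\<phi> l j < m" if "l < m" "j < k" for l j
    using that i k by (auto simp: \<phi>_def)
  have sum: "sum_out i (k, f) = (m, \<lambda>xs\<in>cube m.
      f (take i xs @ True # drop i xs) + f (take i xs @ False # drop i xs))"
    by (simp add: sum_out_def k UNIV_bool add.commute)
  have reindex: "reindex m (\<phi> l) (k, h) = (m, \<lambda>xs\<in>cube m. h (take i xs @ xs ! l # drop i xs))" for l h
    using i unfolding reindex_def prod.case
    by (intro arg_cong[of _ _ "Pair m"] restrict_ext) (simp add: cube_def k insert_eq_map \<phi>_def del: upt_Suc)
  show ?thesis
  proof (cases "\<exists>j. j \<noteq> i \<and> ((i, j) \<in> E \<or> (j, i) \<in> E)")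
    case True
    then obtain j where j: "j \<noteq> i" "(i, j) \<in> E \<or> (j, i) \<in> E" by blast
    then have "j < k" using f(3) by auto
    \<comment> \<open>The position of argument \<open>j\<close> after argument \<open>i\<close> has
      been removed.\<close>
    define l where "l = (if j < i then j else j - 1)"
    have "l < m" using \<open>j < k\<close> i k j(1) by (auto simp: l_def)
    have "f (take i xs @ True # drop i xs) + f (take i xs @ False # drop i xs) =
      f (take i xs @ xs ! l # drop i xs)" if "length xs = m" for xs
    proof -
      \<comment> \<open>The bit opposite to \<open>xs ! l\<close> violates the constraint between
        \<open>i\<close> and \<open>j\<close>, so one of the two summands vanishes.\<close>
      have "f (take i xs @ (\<not> xs ! l) # drop i xs) = 0"
      proof -
        have "(take i xs @ (\<not> xs ! l) # drop i xs) ! i \<noteq> (take i xs @ (\<not> xs ! l) # drop i xs) ! j"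
          using that i k j(1) by (auto simp: nth_insert l_def)
        then have "\<not> (\<forall>(a, b)\<in>E. (take i xs @ (\<not> xs ! l) # drop i xs) ! a =
            (take i xs @ (\<not> xs ! l) # drop i xs) ! b)"
          using j(2) by (metis (mono_tags, lifting) case_prodD)
        then show ?thesis
          unfolding fins[OF that] wprod_def by simp
      qed
      then show ?thesis by (cases "xs ! l") auto
    qed
    then have "sum_out i (k, f) = reindex m (\<phi> l) (k, f)"
      unfolding sum reindex by (auto simp: cube_def fun_eq_iff)
    then show ?thesis
      using reindex_weighted[of T k f "\<phi> l" m] T f0 \<phi> \<open>l < m\<close> by simp
  next
    case False
    \<comment> \<open>Argument \<open>i\<close> now occurs in no constraint except possibly with
      itself, so the sum only turns its weight into the factor \<open>1 + t i\<close>. In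
      \<open>h\<close> this factor sits in the constant and argument \<open>i\<close> has weight 1,
      so \<open>h\<close> does not depend on it.\<close>
    define h where "h = (\<lambda>xs\<in>cube k. wprod k (c * (1 + t i)) (t(i := 1)) E xs)"
    have "0 \<le> t i" using f(2)[OF i] T(3) by auto
    have fb: "f (take i xs @ True # drop i xs) + f (take i xs @ False # drop i xs) =
      h (take i xs @ b # drop i xs)" if xs: "length xs = m" for xs b
    proof -
      let ?P = "\<Prod>j\<in>{..<k} - {i}. weight (t j) ((take i xs @ b # drop i xs) ! j)"
      let ?Q = "of_bool (\<forall>(a, d)\<in>E. (take i xs @ b # drop i xs) ! a = (take i xs @ b # drop i xs) ! d) :: real"
      have *: "(\<Prod>j<k. weight (s j) ((take i xs @ b' # drop i xs) ! j)) = weight (s i) b' * ?P"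
        if "\<And>j. j \<noteq> i \<Longrightarrow> s j = t j" for s b'
      proof -
        have "(\<Prod>j<k. weight (s j) ((take i xs @ b' # drop i xs) ! j)) =
          weight (s i) ((take i xs @ b' # drop i xs) ! i) *
          (\<Prod>j\<in>{..<k} - {i}. weight (s j) ((take i xs @ b' # drop i xs) ! j))"
          using i by (intro prod.remove) auto
        also have "\<dots> = weight (s i) b' * ?P"
          using that i k xs by (intro arg_cong2[of _ _ _ _ "(*)"] prod.cong) (auto simp: nth_insert)
        finally show ?thesis .
      qed
      have E_eq: "((take i xs @ b' # drop i xs) ! a = (take i xs @ b' # drop i xs) ! d) =
          ((take i xs @ b # drop i xs) ! a = (take i xs @ b # drop i xs) ! d)"
        if "(a, d) \<in> E" for a d b'
        using False that i k xs by (cases "a = i"; cases "d = i") (auto simp: nth_insert)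
      have **: "of_bool (\<forall>(a, d)\<in>E. (take i xs @ b' # drop i xs) ! a =
          (take i xs @ b' # drop i xs) ! d) = ?Q" for b'
        by (intro arg_cong[of _ _ of_bool] ball_cong refl)
          (clarify, rule E_eq)
      have "f (take i xs @ b' # drop i xs) = c * (weight (t i) b' * ?P) * ?Q" for b'
        unfolding fins[OF xs] wprod_def **[of b'] by (subst *[of t b']) simp_all
      moreover have "h (take i xs @ b # drop i xs) = c * (1 + t i) * ?P * ?Q"
      proof -
        have "take i xs @ b # drop i xs \<in> cube k"
          using i k xs by (simp add: cube_def)
        then show ?thesis
          unfolding h_def wprod_def using *[of "t(i := 1)" b] by simp
      qed
      ultimately show ?thesis by (simp add: weight_def algebra_simps)
    qed
    show ?thesis
    proof (cases "m = 0")
      case True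
      have "0 \<le> f [b]" for b
        using f(4)[of "[b]"] wprod_nonneg[OF f(1), of k t E "[b]"] f(2) T(3) k True by fastforce
      then show ?thesis
        unfolding sum using True i k by (auto simp: cube_def intro!: weighted_nullary)
    next
      case False
      have "(k, h) \<in> weighted T"
        unfolding h_def by (rule weightedI[of "c * (1 + t i)" _ "t(i := 1)" _ E])
          (use f T \<open>0 \<le> t i\<close> in \<open>auto simp: cube_def\<close>)
      \<comment> \<open>Since \<open>h\<close> ignores argument \<open>i\<close>, any bit may be
        inserted there; the choice \<open>xs ! 0\<close> makes the sum a substitution instance,
        which is why \<open>m\<close> must be positive.\<close>
      moreover have "sum_out i (k, f) = reindex m (\<phi> 0) (k, h)"
        unfolding sum reindex using fb by (auto simp: cube_def fun_eq_iff)
      ultimately show ?thesis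
        using reindex_weighted[of T k h "\<phi> 0" m] T \<phi> False by simp
    qed
  qed
qed

lemma closed_ops_weighted:
  assumes "1 \<in> T" "\<And>x y. x \<in> T \<Longrightarrow> y \<in> T \<Longrightarrow> x * y \<in> T" "T \<subseteq> {0..}"
  shows "closed_ops (weighted T)"
  unfolding closed_ops_def
proof (intro conjI allI impI; elim conjE)
  fix k f i assume "(k, f) \<in> weighted T" "i \<le> k"
  then show "fictitious i (k, f) \<in> weighted T"
    unfolding fictitious_eq_reindex[OF \<open>i \<le> k\<close>] using assms
    by (intro reindex_weighted) auto
next
  fix k f and \<pi> :: "nat \<Rightarrow> nat" assume "(k, f) \<in> weighted T" "\<pi> permutes {..<k}"
  then show "permute_args \<pi> (k, f) \<in> weighted T"
    unfolding permute_args_eq_reindex using assms permutes_in_image[of \<pi> "{..<k}"]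
    by (intro reindex_weighted) auto
qed (use assms in \<open>auto intro: product_weighted sum_out_weighted\<close>)

section \<open>Equality and unary functions in the class\<close>

lemma EQ_weighted:
  assumes "1 \<in> T"
  shows "EQ \<in> weighted T"
  unfolding EQ_def
  by (rule weightedI[of 1 _ "\<lambda>_. 1" _ "{(0, 1)}"]) (use assms in \<open>auto simp: wprod_def cube_def\<close>)

text \<open>The value at \<open>[True]\<close> forces the constant to be 1, and the value at
  \<open>[False]\<close> is then the weight itself; a constraint on a single argument is vacuous.
  Hence \<open>T\<close> is determined by \<open>weighted T\<close>.\<close>

lemma unary_weighted_iff:
  "(1, \<lambda>xs\<in>cube 1. weight t (xs ! 0)) \<in> weighted T \<longleftrightarrow> t \<in> T"
proof
  assume "(1, \<lambda>xs\<in>cube 1. weight t (xs ! 0)) \<in> weighted T"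
  then obtain c s E where s: "s 0 \<in> T" and E: "E \<subseteq> {..<1} \<times> {..<1}"
    and eq: "\<And>xs. length xs = 1 \<Longrightarrow> (\<lambda>xs\<in>cube 1. weight t (xs ! 0)) xs = wprod 1 c s E xs"
    by (rule weightedE) auto
  have E: "(\<forall>(i, j)\<in>E. xs ! i = xs ! j) \<longleftrightarrow> True" for xs :: "bool list"
    using E by auto
  show "t \<in> T"
    using eq[of "[True]"] eq[of "[False]"] s
    by (simp add: cube_def wprod_def weight_def E)
next
  assume "t \<in> T"
  then show "(1, \<lambda>xs\<in>cube 1. weight t (xs ! 0)) \<in> weighted T"
    by (intro weightedI[of 1 _ "\<lambda>_. t" _ "{}"]) (auto simp: wprod_def cube_def)
qed

section \<open>Limits\<close>

text \<open>The coordinates are treated one at a time: each passage to a further subsequence keeps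
  the limits already obtained.\<close>

lemma compact_simultaneous_subseq:
  fixes t :: "nat \<Rightarrow> nat \<Rightarrow> real"
  assumes "compact T" "\<And>n i. i < k \<Longrightarrow> t n i \<in> T"
  obtains r l where "strict_mono (r :: nat \<Rightarrow> nat)"
    "\<And>i. i < k \<Longrightarrow> l i \<in> T \<and> (\<lambda>n. t (r n) i) \<longlonglongrightarrow> l i"
proof -
  from assms(2) have "\<exists>r l. strict_mono (r :: nat \<Rightarrow> nat) \<and>
    (\<forall>i<k. l i \<in> T \<and> (\<lambda>n. t (r n) i) \<longlonglongrightarrow> l i)"
  proof (induction k)
    case 0
    show ?case by (rule exI[of _ id]) (simp add: strict_mono_def)
  next
    case (Suc k)
    then obtain r l where r: "strict_mono (r :: nat \<Rightarrow> nat)"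
      "\<And>i. i < k \<Longrightarrow> l i \<in> T \<and> (\<lambda>n. t (r n) i) \<longlonglongrightarrow> l i"
      by (metis less_SucI)
    obtain a q where q: "a \<in> T" "strict_mono (q :: nat \<Rightarrow> nat)"
      "((\<lambda>n. t (r n) k) \<circ> q) \<longlonglongrightarrow> a"
      using \<open>compact T\<close> Suc.prems[of k] unfolding compact_eq_seq_compact_metric
      by (auto elim!: seq_compactE[where f = "\<lambda>n. t (r n) k"])
    have "(l(k := a)) i \<in> T \<and> (\<lambda>n. t ((r \<circ> q) n) i) \<longlonglongrightarrow> (l(k := a)) i" if "i < Suc k" for i
    proof (cases "i = k")
      case False
      then have "i < k" using that by simp
      then show ?thesis
        using r(2)[of i] LIMSEQ_subseq_LIMSEQ[of "\<lambda>n. t (r n) i" "l i" q] q(2)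
        by (simp add: o_def)
    qed (use q in \<open>simp add: o_def\<close>)
    with strict_mono_o[OF r(1) q(2)] show ?case by blast
  qed
  with that show thesis by blast
qed

text \<open>The representations of the \<open>g n\<close> may vary wildly, but along a suitable
  subsequence the constraint set is constant, the weights converge inside the compact
  \<open>T\<close>, and the constants converge too.\<close>

lemma weighted_LIMSEQ:
  assumes "compact T" and g: "\<And>n. (k, g n) \<in> weighted T"
    and f: "f \<in> extensional (cube k)" "\<And>xs. 0 \<le> f xs \<or> length xs \<noteq> k"
    and lim: "\<And>xs. length xs = k \<Longrightarrow> (\<lambda>n. g n xs) \<longlonglongrightarrow> f xs"
  shows "(k, f) \<in> weighted T"
proof -
  have "\<exists>c t E. 0 \<le> c \<and> (\<forall>i<k. t i \<in> T) \<and> E \<in> Pow ({..<k} \<times> {..<k}) \<and>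
      (\<forall>xs. length xs = k \<longrightarrow> g n xs = wprod k c t E xs)" for n
    by (rule weightedE[OF g[of n]]) blast
  then obtain c t E where
    *: "\<And>n. 0 \<le> c n" "\<And>n i. i < k \<Longrightarrow> t n i \<in> T" "\<And>n. E n \<in> Pow ({..<k} \<times> {..<k})"
      "\<And>n xs. length xs = k \<Longrightarrow> g n xs = wprod k (c n) (t n) (E n) xs"
    by metis
  have "finite (range E)"
    by (rule finite_subset[of _ "Pow ({..<k} \<times> {..<k})"]) (use *(3) in auto)
  \<comment> \<open>There are only finitely many constraint sets on \<open>k\<close> arguments, so
    one of them recurs infinitely often.\<close>
  then obtain E0 where E0: "E0 \<in> Pow ({..<k} \<times> {..<k})" "infinite {n. E n = E0}"
    using pigeonhole_infinite[of UNIV E] *(3) by auto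
  define q where "q = enumerate {n. E n = E0}"
  have q: "strict_mono q" "E (q n) = E0" for n
    using strict_mono_enumerate[OF E0(2)] enumerate_in_set[OF E0(2)] by (auto simp: q_def)
  obtain r l where r: "strict_mono (r :: nat \<Rightarrow> nat)"
    "\<And>i. i < k \<Longrightarrow> l i \<in> T \<and> (\<lambda>n. t (q (r n)) i) \<longlonglongrightarrow> l i"
    using compact_simultaneous_subseq[OF \<open>compact T\<close>, of k "\<lambda>n. t (q n)"] *(2) by metis
  have sub: "(\<lambda>n. g (q (r n)) xs) \<longlonglongrightarrow> f xs" if "length xs = k" for xs
    using LIMSEQ_subseq_LIMSEQ[OF lim[OF that] strict_mono_o[OF q(1) r(1)]] by (simp add: o_def)
  define d where "d = f (replicate k True)"
  \<comment> \<open>Since \<open>weight\<close> is normalised at \<open>True\<close>, the constants are values of the functions.\<close>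
  have "g n (replicate k True) = c n" for n
  proof -
    have "\<forall>(i, j)\<in>E n. replicate k True ! i = replicate k True ! j"
      using *(3)[of n] by auto
    then show ?thesis
      by (subst *(4)) (auto simp: wprod_def weight_def)
  qed
  then have c: "(\<lambda>n. c (q (r n))) \<longlonglongrightarrow> d"
    using sub[of "replicate k True"] by (simp add: d_def)
  \<comment> \<open>For a fixed constraint set, \<open>wprod\<close> is continuous in the constant
    and the weights.\<close>
  have "f xs = wprod k d l E0 xs" if "length xs = k" for xs
  proof (rule LIMSEQ_unique[OF sub[OF that]])
    have "(\<lambda>n. weight (t (q (r n)) i) b) \<longlonglongrightarrow> weight (l i) b" if "i < k" for i b
      using r(2)[OF that] by (simp add: weight_def)
    then show "(\<lambda>n. g (q (r n)) xs) \<longlonglongrightarrow> wprod k d l E0 xs"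
      unfolding *(4)[OF that] q(2) wprod_def
      by (intro tendsto_mult c tendsto_prod tendsto_const) auto
  qed
  moreover have "0 \<le> d"
    using f(2)[of "replicate k True"] by (simp add: d_def)
  ultimately show ?thesis
    using f(1) r(2) E0(1) by (intro weightedI[of d _ l _ E0]) auto
qed

section \<open>A family of clones\<close>

definition weights :: "real set \<Rightarrow> real set" where
  "weights A = {0..1/4} \<union> A \<union> {1}"

lemma weights_mult:
  assumes "A \<subseteq> {1/4<..1/2}" "x \<in> weights A" "y \<in> weights A"
  shows "x * y \<in> weights A"
proof (cases "x = 1 \<or> y = 1")
  case False
  then have "0 \<le> x" "x \<le> 1/2" "0 \<le> y" "y \<le> 1/2"
    using assms by (auto simp: weights_def)
  then have "0 \<le> x * y" "x * y \<le> 1/2 * (1/2)"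
    by (auto intro!: mult_mono simp del: times_divide_eq_left times_divide_eq_right)
  then show ?thesis by (simp add: weights_def)
qed (use assms in auto)

lemma compact_weights: "finite A \<Longrightarrow> compact (weights A)"
  unfolding weights_def by (intro compact_Un) (auto intro: finite_imp_compact)

lemma closed_ops_weighted_weights:
  assumes "A \<subseteq> {1/4<..1/2}"
  shows "closed_ops (weighted (weights A))"
  using assms
  by (intro closed_ops_weighted weights_mult[OF assms]) (auto simp: weights_def)

lemma EQ_weighted_weights: "EQ \<in> weighted (weights A)"
  by (rule EQ_weighted) (simp add: weights_def)

text \<open>Each function involves finitely many weights, and those outside \<open>A\<close> lie in
  \<open>weights A'\<close> for every \<open>A'\<close>. This exploits the finite set in the
  definition of a limit.\<close>

lemma finite_subset_weighted_weights:
  assumes "finite S" "S \<subseteq> weighted (weights A)"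
  obtains A' where "finite A'" "A' \<subseteq> A" "S \<subseteq> weighted (weights A')"
proof -
  from assms have "\<exists>A'. finite A' \<and> A' \<subseteq> A \<and> S \<subseteq> weighted (weights A')"
  proof (induction S)
    case (insert p S)
    then obtain A1 where A1: "finite A1" "A1 \<subseteq> A" "S \<subseteq> weighted (weights A1)" by auto
    obtain k c t E where p: "p = (k, \<lambda>xs\<in>cube k. wprod k c t E xs)"
      and "0 \<le> c" "t ` {..<k} \<subseteq> weights A" "E \<subseteq> {..<k} \<times> {..<k}"
      using insert.prems unfolding weighted_def by auto
    define A2 where "A2 = A1 \<union> (A \<inter> t ` {..<k})"
    have "t ` {..<k} \<subseteq> weights A2"
      using \<open>t ` {..<k} \<subseteq> weights A\<close> by (auto simp: weights_def A2_def)
    then have "p \<in> weighted (weights A2)"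
      unfolding p weighted_def using \<open>0 \<le> c\<close> \<open>E \<subseteq> _\<close> by blast
    moreover have "weighted (weights A1) \<subseteq> weighted (weights A2)"
      by (rule weighted_mono) (auto simp: weights_def A2_def)
    ultimately show ?case
      using A1 by (intro exI[of _ A2]) (auto simp: A2_def)
  qed auto
  with that show thesis by blast
qed

text \<open>For infinite \<open>A\<close> the set \<open>weights A\<close> need not be closed. The
  approximants, however, all lie in the class of one finite \<open>A'\<close>, where compactness
  applies.\<close>

lemma closed_limits_weighted_weights:
  assumes A: "A \<subseteq> {1/4<..1/2}"
  shows "closed_limits (weighted (weights A))"
  unfolding closed_limits_def
proof (intro allI impI)
  fix k f assume "is_limit (weighted (weights A)) k f"
  then obtain S where f: "(k, f) \<in> Bk k" and S: "finite S" "S \<subseteq> weighted (weights A)"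
    and lim: "\<And>\<epsilon>. 0 < \<epsilon> \<Longrightarrow>
      \<exists>g. (k, g) \<in> clone_closure S \<and> (MAX xs\<in>cube k. \<bar>f xs - g xs\<bar>) < \<epsilon>"
    unfolding is_limit_def by blast
  obtain A' where A': "finite A'" "A' \<subseteq> A" "S \<subseteq> weighted (weights A')"
    using finite_subset_weighted_weights[OF S] .
  have cl: "clone_closure S \<subseteq> weighted (weights A')"
    unfolding clone_closure_def using A' A EQ_weighted_weights
    by (intro hull_minimal closed_ops_weighted_weights) auto
  have "\<exists>g. (k, g) \<in> weighted (weights A') \<and> (\<forall>xs\<in>cube k. \<bar>f xs - g xs\<bar> < 1 / real (Suc n))" for n
  proof -
    obtain g where g: "(k, g) \<in> clone_closure S"
      "(MAX xs\<in>cube k. \<bar>f xs - g xs\<bar>) < 1 / real (Suc n)"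
      using lim[of "1 / real (Suc n)"] by auto
    have le: "\<bar>f xs - g xs\<bar> \<le> (MAX xs\<in>cube k. \<bar>f xs - g xs\<bar>)" if "xs \<in> cube k" for xs
      using that by (intro Max_ge) auto
    have "\<bar>f xs - g xs\<bar> < 1 / real (Suc n)" if "xs \<in> cube k" for xs
      using le[OF that] g(2) by (rule le_less_trans)
    with g(1) cl show ?thesis by blast
  qed
  then obtain g where g: "\<And>n. (k, g n) \<in> weighted (weights A')"
    "\<And>n xs. xs \<in> cube k \<Longrightarrow> \<bar>f xs - g n xs\<bar> < 1 / real (Suc n)"
    by metis
  have "(\<lambda>n. g n xs) \<longlonglongrightarrow> f xs" if "length xs = k" for xs
  proof (rule LIMSEQ_I)
    fix e :: real assume "0 < e"
    then obtain N where N: "1 / real (Suc N) < e"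
      using nat_approx_posE by blast
    have "\<bar>g n xs - f xs\<bar> < e" if "n \<ge> N" for n
    proof -
      have "1 / real (Suc n) \<le> 1 / real (Suc N)"
        using that by (intro divide_left_mono) auto
      with N g(2)[of xs n] \<open>length xs = k\<close> show ?thesis
        by (simp add: cube_def abs_minus_commute)
    qed
    then show "\<exists>N. \<forall>n\<ge>N. norm (g n xs - f xs) < e"
      unfolding real_norm_def by blast
  qed
  moreover have "f \<in> extensional (cube k)" "\<And>xs. 0 \<le> f xs \<or> length xs \<noteq> k"
    using f by (auto simp: Bk_def PiE_def Pi_def cube_def)
  ultimately have "(k, f) \<in> weighted (weights A')"
    by (intro weighted_LIMSEQ[OF compact_weights[OF A'(1)] g(1)])
  moreover have "weighted (weights A') \<subseteq> weighted (weights A)"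
    using A'(2) by (intro weighted_mono) (auto simp: weights_def)
  ultimately show "(k, f) \<in> weighted (weights A)" by blast
qed

text \<open>A closed set containing \<open>EQ\<close> is its own hull, so one family serves both
  kinds of clones.\<close>

lemma weighted_weights_clones:
  assumes A: "A \<subseteq> {1/4<..1/2}"
  shows "weighted (weights A) \<in> L_f \<inter> L_omega"
proof -
  have "weighted (weights A) \<subseteq> B"
    using A by (intro weighted_subset_B) (auto simp: weights_def)
  moreover have "weighted (weights A) \<union> {EQ} = weighted (weights A)"
    using EQ_weighted_weights by blast
  ultimately show ?thesis
    using closed_ops_weighted_weights[OF A] closed_limits_weighted_weights[OF A]
    by (simp add: L_f_def L_omega_def functional_clone_def omega_clone_def
        clone_closure_def omega_closure_def hull_same)
qed

text \<open>The unary functions reveal \<open>weights A\<close>; intersecting with the half-open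
  interval, which is disjoint from \<open>{0..1/4}\<close> and misses 1, recovers
  \<open>A\<close>.\<close>

lemma inj_on_weighted_weights: "inj_on (\<lambda>A. weighted (weights A)) (Pow {1/4<..1/2})"
proof (rule inj_onI)
  fix A A' assume A: "A \<in> Pow {1/4<..1/2::real}" "A' \<in> Pow {1/4<..1/2::real}"
    and "weighted (weights A) = weighted (weights A')"
  then have "t \<in> weights A \<longleftrightarrow> t \<in> weights A'" for t
    using unary_weighted_iff[of t "weights A"] unary_weighted_iff[of t "weights A'"] by simp
  moreover have "A'' = weights A'' \<inter> {1/4<..1/2}" if "A'' \<in> Pow {1/4<..1/2}" for A''
    using that by (auto simp: weights_def)
  ultimately show "A = A'"
    using A by (metis subset_antisym subsetI)
qed

section \<open>Cardinalities\<close>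

lemma inj_bfun_nat_set: "\<exists>h :: bfun \<Rightarrow> nat set. inj h"
proof -
  define h :: "bfun \<Rightarrow> nat set" where
    \<comment> \<open>\<open>Inl\<close> records the arity and \<open>Inr\<close> the rationals
      below each value. Bit lists and rationals are countable, so \<open>to_nat\<close> moves
      everything into the naturals.\<close>
    "h = (\<lambda>(k, f). to_nat ` (insert (Inl k) (Inr ` {(xs, q :: rat). of_rat q < f xs})))"
  have "p = p'" if eq: "h p = h p'" for p p'
  proof -
    obtain k f k' f' where p: "p = (k, f)" "p' = (k', f')"
      by (cases p; cases p')
    have set_eq: "insert (Inl k) (Inr ` {(xs, q :: rat). of_rat q < f xs}) =
        insert (Inl k') (Inr ` {(xs, q :: rat). of_rat q < f' xs})"
      using eq unfolding h_def p prod.case inj_image_eq_iff[OF inj_to_nat] .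
    have "k = k'"
      using set_eq by (auto dest: equalityD1)
    have lt: "of_rat q < f xs \<longleftrightarrow> of_rat q < f' xs" for q xs
    proof -
      have "Inr (xs, q) \<in> insert (Inl k) (Inr ` {(xs, q :: rat). of_rat q < f xs}) \<longleftrightarrow>
        Inr (xs, q) \<in> insert (Inl k') (Inr ` {(xs, q :: rat). of_rat q < f' xs})"
        unfolding set_eq ..
      then show ?thesis by auto
    qed
    have "f xs = f' xs" for xs
      using of_rat_dense[of "f xs" "f' xs"] of_rat_dense[of "f' xs" "f xs"] lt
      by (metis less_asym linorder_neqE)
    with \<open>k = k'\<close> show ?thesis by (auto simp: p)
  qed
  then have "inj h" by (intro injI) blast
  then show ?thesis by blast
qed

text \<open>The annotation is the type of \<open>UNIV\<close> itself, so its elements have type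
  \<open>nat set set\<close>; hence two power set steps above the naturals, not three.\<close>

lemma card_beth_two: "|UNIV :: nat set set set| =o ctwo ^c (ctwo ^c natLeq)"
proof -
  have Pow: "|Pow A| =o ctwo ^c |A|" for A :: "'a set"
    unfolding ctwo_def cexp_def Field_card_of by (rule card_of_Pow_Func)
  have "|UNIV :: nat set set| =o ctwo ^c |UNIV :: nat set|"
    using Pow[of "UNIV :: nat set"] by simp
  also have "ctwo ^c |UNIV :: nat set| =o ctwo ^c natLeq"
    by (rule cexp_cong2[OF card_of_nat Card_order_ctwo card_of_Card_order])
  finally have 1: "|UNIV :: nat set set| =o ctwo ^c natLeq" .
  have "|UNIV :: nat set set set| =o ctwo ^c |UNIV :: nat set set|"
    using Pow[of "UNIV :: nat set set"] by simp
  also have "ctwo ^c |UNIV :: nat set set| =o ctwo ^c (ctwo ^c natLeq)"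
    by (rule cexp_cong2[OF 1 Card_order_ctwo card_of_Card_order])
  finally show ?thesis .
qed

lemma card_clones:
  assumes "\<And>A. A \<subseteq> {1/4<..1/2} \<Longrightarrow> weighted (weights A) \<in> L"
  shows "|L| =o |UNIV :: nat set set set|"
proof -
  obtain g :: "nat set \<Rightarrow> real" where g: "inj g" "range g \<subseteq> {0..<1}"
    using nat_sets_lepoll_reals01 unfolding lepoll_def by blast
  \<comment> \<open>An affine map that reverses \<open>{0..<1}\<close> onto
    \<open>{1/4<..1/2}\<close>, so sets of naturals become distinct admissible weights.\<close>
  define u where "u N = 1/2 - g N / 4" for N
  have u: "inj u" "range u \<subseteq> {1/4<..1/2}"
    using g by (auto simp: u_def inj_def image_subset_iff)
  have "inj (\<lambda>X. weighted (weights (u ` X)))"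
  proof (rule injI)
    fix X Y assume "weighted (weights (u ` X)) = weighted (weights (u ` Y))"
    then have "u ` X = u ` Y"
      using u(2) by (intro inj_onD[OF inj_on_weighted_weights]) auto
    then show "X = Y"
      using u(1) by (simp add: inj_image_eq_iff)
  qed
  moreover have "weighted (weights (u ` X)) \<in> L" for X
    by (rule assms) (use u(2) in auto)
  ultimately have ge: "|UNIV :: nat set set set| \<le>o |L|"
    by (rule card_of_ordLeqI)
  obtain h :: "bfun \<Rightarrow> nat set" where "inj h"
    using inj_bfun_nat_set by blast
  \<comment> \<open>The upper bound comes from the type alone: every set of functions is encoded by
    the set of codes of its members.\<close>
  then have "inj_on (image h) L"
    by (intro inj_onI) (simp add: inj_image_eq_iff)
  then have "|L| \<le>o |UNIV :: nat set set set|"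
    by (rule card_of_ordLeqI) simp
  with ge show ?thesis
    by (simp add: ordIso_iff_ordLeq)
qed

theorem theorem3p4:
  shows "|L_f| =o |L_omega| \<and> |L_omega| =o ctwo ^c (ctwo ^c natLeq)"
proof -
  have f: "|L_f| =o |UNIV :: nat set set set|"
    by (rule card_clones) (rule IntD1[OF weighted_weights_clones])
  have \<omega>: "|L_omega| =o |UNIV :: nat set set set|"
    by (rule card_clones) (rule IntD2[OF weighted_weights_clones])
  show ?thesis
    using ordIso_transitive[OF f ordIso_symmetric[OF \<omega>]] ordIso_transitive[OF \<omega> card_beth_two]
    by (rule conjI)
qed

end
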